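(* Let $z\in\mathbb{C}$ with $0<|z|<1$, $-\pi<\arg z<\pi$, and $z\notin(0,1)$. Let $\ln z$ be the principal logarithm, $\varphi=\arg(-\ln z)$, and $z^{-a}=e^{-a\ln z}$. Let $n\in\{1,2,\ldots\}$ and $a\in\mathbb{C}\setminus\mathbb{Z}$. Then $$\Phi(z,n,a)+(-1)^n z^{-1}\,\Phi(z^{-1},n,1-a)=\frac{\pi(-1)^{n-1}}{(n-1)!}\,\frac{\partial^{n-1}}{\partial a^{n-1}}\Big(z^{-a}\big(\cot(\pi a)-\operatorname{sgn}(\varphi)\,i\big)\Big).$$
   Context: The Lerch transcendent is defined by $\Phi(z,s,a)=\sum_{m=0}^{\infty}\frac{z^m}{(a+m)^s}$ for $|z|<1$, $a\neq 0,-1,-2,\ldots$, and elsewhere by analytic continuation. In particular, for $w\in\mathbb{C}\setminus[1,\infty)$, $\Re s>0$, $\Re b>0$, one has $\Phi(w,s,b)=\frac{1}{\Gamma(s)}\int_0^\infty\frac{t^{s-1}e^{-bt}}{1-we^{-t}}\,dt$, and for fixed such $w$ and positive integer $n$, $\Phi(w,n,b)$ is continued to a meromorphic function of $b\in\mathbb{C}$ with poles only at $b=0,-1,-2,\ldots$; this is the meaning of $\Phi(z^{-1},n,1-a)$ here. $\operatorname{sgn}$ is the sign function (note $\varphi\neq0$ under the hypotheses). *)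

theory Defs
  imports "HOL-Complex_Analysis.Complex_Analysis"
begin

definition lerch_series :: "complex \<Rightarrow> complex \<Rightarrow> complex \<Rightarrow> complex" where
  "lerch_series z s a = (\<Sum>m. z ^ m / (a + of_nat m) powr s)"

definition lerch_integral :: "complex \<Rightarrow> complex \<Rightarrow> complex \<Rightarrow> complex" where
  "lerch_integral w s b =
     1 / Gamma s *
     integral {0<..} (\<lambda>t::real. of_real t powr (s - 1) * exp (- b * of_real t) /
                                (1 - w * exp (- of_real t)))"

definition lerch_continuation :: "complex \<Rightarrow> nat \<Rightarrow> (complex \<Rightarrow> complex) \<Rightarrow> bool" where
  "lerch_continuation w n F \<longleftrightarrow>
     F meromorphic_on UNIV \<and> F holomorphic_on (- \<int>\<^sub>\<le>\<^sub>0) \<and>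
     (\<forall>b. Re b > 0 \<longrightarrow> F b = lerch_integral w (of_nat n) b)"

text \<open>The Lerch transcendent at a positive integer order. In the second branch, for
  \<open>w\<close> off the cut \<open>[1, \<infinity>)\<close>, the continuation is determined on the connected set
  \<open>- \<int>\<^sub>\<le>\<^sub>0\<close> by the identity theorem; only its values at the poles depend on the choice.
  The value for \<open>w\<close> on the cut is not meaningful.\<close>

definition lerch_phi :: "complex \<Rightarrow> nat \<Rightarrow> complex \<Rightarrow> complex" where
  "lerch_phi w n b =
     (if norm w < 1 then lerch_series w (of_nat n) b
      else (SOME F. lerch_continuation w n F) b)"

end

theory Submission
  imports Defs
begin

text \<open>
  For \<open>Re b > 0\<close> and \<open>w\<close> off \<open>[1, \<infinity>)\<close> put
  \<open>J w k b = \<integral>\<^sub>0\<^sup>\<infinity> t^k exp (-b t) / (1 - w exp (-t)) dt\<close>. Expanding finitely many terms of the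
  geometric series gives \<open>J w k b / k! = (\<Sum>m<M. w^m / (b+m)^(k+1)) + w^M J w k (b+M) / k!\<close>; the
  right-hand side makes sense for \<open>Re b > -M\<close> and yields the continuation in \<open>b\<close>, and for
  \<open>norm w \<le> 1\<close> letting \<open>M\<close> tend to infinity identifies it with the Lerch series.

  Differentiation in \<open>b\<close> raises the order \<open>n\<close>, so everything reduces to \<open>n = 1\<close>, and by the
  identity theorem to \<open>0 < Re a < 1\<close>. Write \<open>z = - exp c\<close> with \<open>\<bar>Im c\<bar> < pi\<close>. Integration by parts
  turns into a first-order differential equation in \<open>w\<close> for \<open>J w 0 b\<close>, from which the left-hand
  side \<open>K c\<close> of the formula satisfies \<open>K' = - a K\<close>. Hence \<open>K c = exp (- a c) K 0\<close>, and
  \<open>K 0 = \<Sum>m. (-1)^m (1/(a+m) + 1/(1-a+m)) = pi / sin (pi a)\<close> by the reflection formula of the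
  digamma function.
\<close>

subsection \<open>Laplace-type integrals\<close>

text \<open>Dominated convergence is applied to the difference quotients along an arbitrary sequence
  tending to \<open>x\<close>. The mean value inequality on the convex set \<open>S\<close> turns
  the bound on the derivative into a bound on the quotients by the same \<open>g\<close>.\<close>

lemma has_field_derivative_set_lebesgue_integral:
  fixes f f' :: "complex \<Rightarrow> 'a \<Rightarrow> complex"
  assumes "open S" "convex S" "x \<in> S"
    and int: "\<And>y. y \<in> S \<Longrightarrow> set_integrable M A (f y)"
    and der: "\<And>y t. y \<in> S \<Longrightarrow> t \<in> A \<Longrightarrow> ((\<lambda>y. f y t) has_field_derivative f' y t) (at y)"
    and bound: "\<And>y t. y \<in> S \<Longrightarrow> t \<in> A \<Longrightarrow> norm (f' y t) \<le> g t"
    and meas: "set_borel_measurable M A (f' x)"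
    and g: "set_integrable M A g"
  shows "((\<lambda>y. LINT t:A|M. f y t) has_field_derivative (LINT t:A|M. f' x t)) (at x)"
proof -
  have "((\<lambda>y. ((LINT t:A|M. f y t) - (LINT t:A|M. f x t)) / (y - x))
          \<longlongrightarrow> (LINT t:A|M. f' x t)) (at x within S)"
    unfolding tendsto_at_iff_sequentially
  proof (intro allI impI)
    fix X assume X: "\<forall>i. X i \<in> S - {x}" and lim: "X \<longlonglongrightarrow> x"
    define q where "q i t = (f (X i) t - f x t) / (X i - x)" for i t
    have qint: "set_integrable M A (q i)" for i
      unfolding q_def using X \<open>x \<in> S\<close> by (intro set_integrable_divide set_integral_diff int) auto
    have qlim: "(\<lambda>i. q i t) \<longlonglongrightarrow> f' x t" if "t \<in> A" for t
    proof -
      have "((\<lambda>y. (f y t - f x t) / (y - x)) \<longlongrightarrow> f' x t) (at x)"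
        using der[OF \<open>x \<in> S\<close> that] by (simp add: has_field_derivative_iff)
      moreover have "filterlim X (at x) sequentially"
        using X lim by (auto simp: filterlim_at)
      ultimately show ?thesis unfolding q_def by (rule filterlim_compose)
    qed
    have qbound: "norm (q i t) \<le> g t" if "t \<in> A" for i t
    proof -
      have "norm (f (X i) t - f x t) \<le> g t * norm (X i - x)"
        using X \<open>x \<in> S\<close> that
        by (intro field_differentiable_bound[OF \<open>convex S\<close>, of "\<lambda>y. f y t" "\<lambda>y. f' y t"])
           (auto intro: has_field_derivative_at_within der bound)
      moreover have "norm (X i - x) > 0" using X by auto
      ultimately show ?thesis by (simp add: q_def norm_divide pos_divide_le_eq)
    qed
    have "(\<lambda>i. LINT t:A|M. q i t) \<longlonglongrightarrow> (LINT t:A|M. f' x t)"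
      unfolding set_lebesgue_integral_def
    proof (rule integral_dominated_convergence)
      show "(\<lambda>t. indicator A t *\<^sub>R f' x t) \<in> borel_measurable M"
        using meas by (simp add: set_borel_measurable_def)
      show "(\<lambda>t. indicator A t *\<^sub>R q i t) \<in> borel_measurable M" for i
        using qint[of i] by (auto simp: set_integrable_def)
      show "integrable M (\<lambda>t. indicator A t *\<^sub>R g t)"
        using g by (simp add: set_integrable_def)
      show "AE t in M. (\<lambda>i. indicator A t *\<^sub>R q i t) \<longlonglongrightarrow> indicator A t *\<^sub>R f' x t"
        using qlim by (intro always_eventually) (auto simp: indicator_def)
      show "AE t in M. norm (indicator A t *\<^sub>R q i t) \<le> indicator A t *\<^sub>R g t" for i
        using qbound by (intro always_eventually) (auto simp: indicator_def)
    qed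
    moreover have "(LINT t:A|M. q i t) = ((LINT t:A|M. f (X i) t) - (LINT t:A|M. f x t)) / (X i - x)" for i
      unfolding q_def using X \<open>x \<in> S\<close> by (simp add: int set_integral_diff)
    ultimately show "((\<lambda>y. ((LINT t:A|M. f y t) - (LINT t:A|M. f x t)) / (y - x)) \<circ> X) \<longlonglongrightarrow> (LINT t:A|M. f' x t)"
      by (simp add: o_def)
  qed
  thus ?thesis
    using at_within_open[OF \<open>x \<in> S\<close> \<open>open S\<close>] by (simp add: has_field_derivative_iff)
qed

lemma has_field_derivative_inverse_power_shift:
  fixes b c :: complex
  assumes "b + c \<noteq> 0"
  shows "((\<lambda>b. inverse ((b + c) ^ Suc k)) has_field_derivative
            - (of_nat (Suc k) / (b + c) ^ Suc (Suc k))) (at b)"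
proof -
  have "((\<lambda>b. (b + c) ^ Suc k) has_field_derivative (1 + of_nat k) * (1 * (b + c) ^ k)) (at b)"
    by (intro DERIV_power_Suc) (auto intro!: derivative_eq_intros)
  hence "((\<lambda>b. inverse ((b + c) ^ Suc k)) has_field_derivative
           - ((1 + of_nat k) * (1 * (b + c) ^ k) * inverse (((b + c) ^ Suc k) ^ Suc (Suc 0)))) (at b)"
    by (rule DERIV_inverse_fun) (use assms in auto)
  also have "(1 + of_nat k) * (1 * (b + c) ^ k) * inverse (((b + c) ^ Suc k) ^ Suc (Suc 0)) =
      of_nat (Suc k) / (b + c) ^ Suc (Suc k)"
    using assms by (simp add: divide_simps)
  finally show ?thesis .
qed

section \<open>Moment integrals over the plane slit along [1, infinity)\<close>

definition lerch_domain :: "complex set" where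
  "lerch_domain = - (complex_of_real ` {1..})"

lemma open_lerch_domain: "open lerch_domain"
  unfolding lerch_domain_def
  by (intro open_Compl closed_injective_linear_image) (auto simp: linear_of_real inj_on_def)

text \<open>A zero of the denominator would force \<open>w = exp t\<close>, a point of the cut. With
  \<open>u = exp (- t)\<close> the half-line is mapped into the compact interval from 0 to 1, so a
  positive minimum exists. Uniformity over \<open>K\<close> serves the differentiation in
  \<open>w\<close>.\<close>

lemma lerch_domain_denominator_bound:
  assumes "compact K" "K \<subseteq> lerch_domain"
  obtains d where "d > 0" "\<And>w t::real. w \<in> K \<Longrightarrow> t \<ge> 0 \<Longrightarrow> norm (1 - w * exp (- of_real t)) \<ge> d"
proof -
  have nz: "1 - w * of_real u \<noteq> 0" if "w \<in> K" "u \<in> {0..1}" for w and u :: real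
  proof
    assume "1 - w * of_real u = 0"
    hence "u \<noteq> 0" "w * of_real u = 1" by auto
    hence "w = of_real (1 / u)" by (simp add: nonzero_eq_divide_eq)
    moreover have "1 / u \<ge> 1" using that \<open>u \<noteq> 0\<close> by (auto simp: field_simps)
    ultimately have "w \<in> complex_of_real ` {1..}" by blast
    thus False using that assms by (auto simp: lerch_domain_def)
  qed
  have im: "compact ((\<lambda>(w, u::real). norm (1 - w * of_real u)) ` (K \<times> {0..1}))"
    by (intro compact_continuous_image compact_Times assms compact_Icc)
       (auto simp: case_prod_unfold intro!: continuous_intros)
  \<comment> \<open>The extra element 1 keeps \<open>Q\<close> nonempty when \<open>K\<close> is
    empty.\<close>
  define Q where "Q = insert 1 ((\<lambda>(w, u::real). norm (1 - w * of_real u)) ` (K \<times> {0..1}))"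
  have "compact Q" "Q \<noteq> {}" using im by (auto simp: Q_def)
  then obtain d where d: "d \<in> Q" "\<And>x. x \<in> Q \<Longrightarrow> d \<le> x"
    using compact_attains_inf[of Q] by metis
  have "d > 0" using d(1) nz by (auto simp: Q_def)
  moreover have "norm (1 - w * exp (- of_real t)) \<ge> d" if "w \<in> K" "t \<ge> 0" for w and t :: real
  proof -
    have "(w, exp (-t)) \<in> K \<times> {0..1}" using that by auto
    hence "norm (1 - w * of_real (exp (-t))) \<in> Q"
      unfolding Q_def by (intro insertI2 image_eqI[of _ _ "(w, exp (-t))"]) auto
    thus ?thesis using d(2) by (simp add: exp_of_real flip: of_real_minus)
  qed
  ultimately show ?thesis using that by blast
qed

lemma lerch_domain_denominator_nonzero:
  assumes "w \<in> lerch_domain" "t \<ge> (0::real)"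
  shows "1 - w * exp (- of_real t) \<noteq> 0"
proof -
  obtain d where "d > 0" "norm (1 - w * exp (- of_real t)) \<ge> d"
    using lerch_domain_denominator_bound[of "{w}"] assms by (metis compact_sing empty_subsetI insert_subset singletonI)
  thus ?thesis by auto
qed

text \<open>These are the dominating functions used below. Each is the modulus of a complex Gamma
  integrand at the argument k + 1, hence absolutely integrable.\<close>

lemma power_exp_integrable:
  fixes c :: real
  assumes "c > 0"
  shows "set_integrable lborel {0<..} (\<lambda>t. t ^ k * exp (- c * t))"
proof -
  have "(\<lambda>t. complex_of_real t powr (of_nat (Suc k) - 1) / of_real (exp (c * t)))
             absolutely_integrable_on {0<..}"
    by (rule absolutely_integrable_Gamma_integral) (use assms in auto)
  hence "(\<lambda>t. norm (complex_of_real t powr (of_nat (Suc k) - 1) / of_real (exp (c * t))))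
             absolutely_integrable_on {0<..}"
    by (rule set_integrable_norm)
  also have "?this \<longleftrightarrow> (\<lambda>t. t ^ k * exp (- c * t)) absolutely_integrable_on {0<..}"
  proof (intro set_integrable_cong refl)
    fix t :: real assume "t \<in> {0<..}"
    hence "complex_of_real t powr (of_nat (Suc k) - 1) = of_real t ^ k"
      by (simp add: powr_nat')
    thus "norm (complex_of_real t powr (of_nat (Suc k) - 1) / of_real (exp (c * t))) = t ^ k * exp (- c * t)"
      using \<open>t \<in> {0<..}\<close> by (simp only: norm_divide norm_power norm_of_real) (simp add: exp_minus divide_inverse)
  qed
  finally have *: "set_integrable lebesgue {0<..} (\<lambda>t. t ^ k * exp (- c * t))" .
  show ?thesis
    unfolding set_integrable_def
    using * by (subst (asm) set_integrable_def, subst (asm) integrable_completion) auto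
qed

text \<open>The integral J of the overview: for \<open>Re b > 0\<close> it is k! times the Lerch
  transcendent of order k + 1.\<close>

definition lerch_moment :: "complex \<Rightarrow> nat \<Rightarrow> complex \<Rightarrow> complex" where
  "lerch_moment w k b =
     (LINT t:{0<..}|lborel. of_real t ^ k * exp (- b * of_real t) / (1 - w * exp (- of_real t)))"

text \<open>The exponent \<open>j\<close> covers both the moment (\<open>j = 1\<close>) and its
  derivative in \<open>w\<close> (\<open>j = 2\<close>). Since the denominator stays away from 0, a
  multiple of a Gamma integrand dominates.\<close>

lemma lerch_integrable:
  assumes "Re b > 0" "w \<in> lerch_domain"
  shows "set_integrable lborel {0<..}
           (\<lambda>t. of_real t ^ k * exp (- b * of_real t) / (1 - w * exp (- of_real t)) ^ j)"
proof -
  obtain d where d: "d > 0" "\<And>t::real. t \<ge> 0 \<Longrightarrow> norm (1 - w * exp (- of_real t)) \<ge> d"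
    using lerch_domain_denominator_bound[of "{w}"] assms
    by (metis compact_sing empty_subsetI insert_subset singletonI)
  have "set_integrable lborel {0<..} (\<lambda>t. t ^ k * exp (- Re b * t) / d ^ j)"
    by (intro set_integrable_divide power_exp_integrable assms)
  thus ?thesis
  proof (rule set_integrable_bound)
    show "set_borel_measurable lborel {0<..}
           (\<lambda>t. complex_of_real t ^ k * exp (- b * of_real t) / (1 - w * exp (- of_real t)) ^ j)"
      unfolding set_borel_measurable_def by measurable
    show "AE t in lborel. t \<in> {0<..} \<longrightarrow>
            norm (complex_of_real t ^ k * exp (- b * of_real t) / (1 - w * exp (- of_real t)) ^ j)
              \<le> norm (t ^ k * exp (- Re b * t) / d ^ j)"
    proof (intro always_eventually allI impI)
      fix t :: real assume t: "t \<in> {0<..}"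
      have "norm (complex_of_real t ^ k * exp (- b * of_real t) / (1 - w * exp (- of_real t)) ^ j)
              = t ^ k * exp (- Re b * t) / norm (1 - w * exp (- of_real t)) ^ j"
        using t by (simp add: norm_divide norm_mult norm_power)
      also have "\<dots> \<le> t ^ k * exp (- Re b * t) / d ^ j"
        using t d by (intro frac_le power_mono mult_nonneg_nonneg) auto
      finally show "norm (complex_of_real t ^ k * exp (- b * of_real t) / (1 - w * exp (- of_real t)) ^ j)
              \<le> norm (t ^ k * exp (- Re b * t) / d ^ j)" using t d by (simp add: abs_mult)
    qed
  qed
qed

lemma lerch_moment_has_field_derivative:
  assumes "Re b > 0" "w \<in> lerch_domain"
  shows "(lerch_moment w k has_field_derivative - lerch_moment w (Suc k) b) (at b)"
proof -
  define f where "f b t = of_real t ^ k * exp (- b * of_real t) / (1 - w * exp (- of_real t))"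
    for b :: complex and t :: real
  define f' where "f' b t = - (of_real t ^ Suc k * exp (- b * of_real t) / (1 - w * exp (- of_real t)) ^ 1)"
    for b :: complex and t :: real
  \<comment> \<open>Halving \<open>Re b\<close> leaves a neighbourhood of \<open>b\<close> on which
    one function of decay rate \<open>Re b / 2\<close> dominates all derivatives.\<close>
  define S where "S = {c. Re c > Re b / 2}"
  obtain d where d: "d > 0" "\<And>t::real. t \<ge> 0 \<Longrightarrow> norm (1 - w * exp (- of_real t)) \<ge> d"
    using lerch_domain_denominator_bound[of "{w}"] assms
    by (metis compact_sing empty_subsetI insert_subset singletonI)
  have "((\<lambda>b. LINT t:{0<..}|lborel. f b t) has_field_derivative (LINT t:{0<..}|lborel. f' b t)) (at b)"
  proof (rule has_field_derivative_set_lebesgue_integral)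
    show "open S" "convex S" "b \<in> S"
      using assms open_halfspace_Re_gt convex_halfspace_Re_gt by (auto simp: S_def simp del: less_divide_eq_numeral1 divide_less_eq_numeral1)
    show "set_integrable lborel {0<..} (f c)" if "c \<in> S" for c
      using lerch_integrable[of c w k 1] that assms by (simp add: S_def f_def[abs_def])
    show "((\<lambda>c. f c t) has_field_derivative f' c t) (at c)" if "t \<in> {0<..}" for c t
      using lerch_domain_denominator_nonzero[OF assms(2), of t] that
      unfolding f_def f'_def by (auto intro!: derivative_eq_intros)
    show "norm (f' c t) \<le> t ^ Suc k * exp (- (Re b / 2) * t) / d" if "c \<in> S" "t \<in> {0<..}" for c t
    proof -
      have "Re b / 2 * t \<le> Re c * t" using that by (intro mult_right_mono) (auto simp: S_def)
      thus ?thesis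
        using that d unfolding f'_def norm_minus_cancel norm_divide norm_mult norm_power power_one_right
        by (intro frac_le mult_mono) auto
    qed
    show "set_integrable lborel {0<..} (\<lambda>t. t ^ Suc k * exp (- (Re b / 2) * t) / d)"
      using assms by (intro set_integrable_divide power_exp_integrable) auto
    show "set_borel_measurable lborel {0<..} (f' b)"
      unfolding f'_def set_borel_measurable_def by measurable
  qed
  thus ?thesis
    by (simp add: f_def f'_def lerch_moment_def[abs_def] set_lebesgue_integral_def)
qed

text \<open>The derivative of \<open>lerch_moment w 0 b\<close> in \<open>w\<close>, taken under the
  integral; the factor \<open>exp (- t)\<close> produced by the denominator is absorbed into
  \<open>b + 1\<close>.\<close>

definition lerch_moment_deriv :: "complex \<Rightarrow> complex \<Rightarrow> complex" where
  "lerch_moment_deriv w b =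
     (LINT t:{0<..}|lborel. exp (- (b + 1) * of_real t) / (1 - w * exp (- of_real t))\<^sup>2)"

lemma lerch_moment_has_field_derivative_arg:
  assumes "Re b > 0" "w \<in> lerch_domain"
  shows "((\<lambda>w. lerch_moment w 0 b) has_field_derivative lerch_moment_deriv w b) (at w)"
proof -
  define f where "f w t = exp (- b * of_real t) / (1 - w * exp (- of_real t))"
    for w :: complex and t :: real
  define f' where "f' w t = exp (- (b + 1) * of_real t) / (1 - w * exp (- of_real t))\<^sup>2"
    for w :: complex and t :: real
  \<comment> \<open>A closed disc is compact, so a single lower bound \<open>d\<close> on the
    denominator holds for all \<open>v\<close> near \<open>w\<close>.\<close>
  obtain r where r: "r > 0" "cball w r \<subseteq> lerch_domain"
    using open_lerch_domain assms(2) open_contains_cball by blast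
  obtain d where d: "d > 0"
    "\<And>v t::real. v \<in> cball w r \<Longrightarrow> t \<ge> 0 \<Longrightarrow> norm (1 - v * exp (- of_real t)) \<ge> d"
    using lerch_domain_denominator_bound[OF compact_cball r(2)] by blast
  have "((\<lambda>w. LINT t:{0<..}|lborel. f w t) has_field_derivative (LINT t:{0<..}|lborel. f' w t)) (at w)"
  proof (rule has_field_derivative_set_lebesgue_integral)
    show "open (ball w r)" "convex (ball w r)" "w \<in> ball w r"
      using r by auto
    show "set_integrable lborel {0<..} (f v)" if "v \<in> ball w r" for v
    proof -
      have "v \<in> lerch_domain" using that r by auto
      thus ?thesis using lerch_integrable[of b v 0 1] assms by (simp add: f_def[abs_def])
    qed
    show "((\<lambda>v. f v t) has_field_derivative f' v t) (at v)" if "v \<in> ball w r" "t \<in> {0<..}" for v t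
    proof -
      have "v \<in> lerch_domain" using that r by auto
      hence nz: "1 - v * exp (- of_real t) \<noteq> 0"
        using lerch_domain_denominator_nonzero[of v t] that by auto
      have "((\<lambda>v. f v t) has_field_derivative
              (exp (- b * of_real t) * exp (- of_real t) / (1 - v * exp (- of_real t))\<^sup>2)) (at v)"
        using nz unfolding f_def
        by (auto intro!: derivative_eq_intros simp: power2_eq_square)
      thus ?thesis by (simp add: f'_def algebra_simps flip: exp_add)
    qed
    show "norm (f' v t) \<le> t ^ 0 * exp (- (Re b + 1) * t) / d\<^sup>2" if "v \<in> ball w r" "t \<in> {0<..}" for v t
      using that d unfolding f'_def norm_divide norm_mult norm_power
      by (intro frac_le power_mono) auto
    show "set_integrable lborel {0<..} (\<lambda>t. t ^ 0 * exp (- (Re b + 1) * t) / d\<^sup>2)"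
      using assms by (intro set_integrable_divide power_exp_integrable) auto
    show "set_borel_measurable lborel {0<..} (f' w)"
      unfolding f'_def set_borel_measurable_def by measurable
  qed
  thus ?thesis
    by (simp add: f_def f'_def lerch_moment_def lerch_moment_deriv_def)
qed

text \<open>The left-hand side is the integral of the total derivative of F(t) = - exp (-b t) / (1 -
  w exp (-t)), which tends to 0 at infinity and equals -1 / (1 - w) at t = 0.\<close>

lemma lerch_moment_ode:
  assumes "Re b > 0" "w \<in> lerch_domain"
  shows "w * lerch_moment_deriv w b + b * lerch_moment w 0 b = 1 / (1 - w)"
proof -
  define F where "F t = - exp (- b * of_real t) / (1 - w * exp (- of_real t))" for t :: real
  define f1 where "f1 t = exp (- b * of_real t) / (1 - w * exp (- of_real t))" for t :: real
  define f2 where "f2 t = exp (- (b + 1) * of_real t) / (1 - w * exp (- of_real t))\<^sup>2" for t :: real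
  define f where "f t = w * f2 t + b * f1 t" for t
  note nz = lerch_domain_denominator_nonzero[OF assms(2)]
  have int1: "set_integrable lborel {0<..} f1"
    using lerch_integrable[of b w 0 1] assms by (simp add: f1_def[abs_def])
  have int2: "set_integrable lborel {0<..} f2"
    using lerch_integrable[of "b + 1" w 0 2] assms by (simp add: f2_def[abs_def])
  have E: "einterval 0 \<infinity> = {0<..}" by (auto simp: einterval_def)
  have "(LBINT t=0..\<infinity>. f t) = 0 - F 0"
  proof (rule interval_integral_FTC_integrable)
    show "(F has_vector_derivative f t) (at t)" if "0 < ereal t" for t
    proof -
      have e: "exp (- (b + 1) * of_real t) = exp (- b * of_real t) * exp (- of_real t)"
        by (simp add: algebra_simps flip: exp_add)
      \<comment> \<open>\<open>G\<close> extends \<open>F\<close> to a complex variable, so that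
        complex differentiation applies before restricting to the real line.\<close>
      define G where "G z = - exp (- b * z) / (1 - w * exp (- z))" for z
      have "(G has_field_derivative f t) (at (of_real t))"
      proof -
        \<comment> \<open>\<open>E\<close>, \<open>q\<close> and \<open>D\<close> stand for exp (-b
          t), exp (-t) and the denominator, which keeps the exponentials out of the algebra.\<close>
        have alg: "- ((- (E * b * D) - E * (q * w)) / (D * D)) = w * (E * q / D\<^sup>2) + b * (E / D)"
          if "D \<noteq> 0" for E q D :: complex
          using that by (simp add: field_simps power2_eq_square)
        have "(G has_field_derivative
                 - ((- (exp (- b * of_real t) * b * (1 - w * exp (- of_real t))) -
                   exp (- b * of_real t) * (exp (- of_real t) * w)) /
                 ((1 - w * exp (- of_real t)) * (1 - w * exp (- of_real t))))) (at (of_real t))"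
          using nz[of t] that unfolding G_def by (auto intro!: derivative_eq_intros)
        thus ?thesis
          using nz[of t] that unfolding f_def f1_def f2_def e by (subst (asm) alg) auto
      qed
      hence "((\<lambda>t. G (of_real t)) has_vector_derivative f t) (at t)"
        by (rule has_vector_derivative_real_field)
      thus ?thesis by (simp add: G_def F_def[abs_def])
    qed
    show "isCont f t" if "0 < ereal t" for t
      unfolding f_def f1_def f2_def using nz[of t] that by (intro continuous_intros) auto
    show "set_integrable lborel (einterval 0 \<infinity>) f"
      unfolding E f_def by (intro set_integral_add set_integrable_mult_right int1 int2)
    have "isCont F 0" unfolding F_def using nz[of 0] by (intro continuous_intros) auto
    hence "(F \<longlongrightarrow> F 0) (at_right 0)"
      unfolding isCont_def by (rule tendsto_within_subset) auto
    thus "((F \<circ> real_of_ereal) \<longlongrightarrow> F 0) (at_right 0)"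
      unfolding zero_ereal_def ereal_tendsto_simps .
    have "(F \<longlongrightarrow> - 0 / (1 - w * 0)) at_top"
      unfolding F_def
    proof (intro tendsto_intros)
      have *: "((\<lambda>t. exp (- c * complex_of_real t)) \<longlongrightarrow> 0) at_top" if "Re c > 0" for c
      proof (rule tendsto_norm_zero_cancel)
        have "((\<lambda>t. exp (- (Re c * t))) \<longlongrightarrow> 0) at_top"
          using that by real_asymp
        thus "((\<lambda>t. norm (exp (- c * complex_of_real t))) \<longlongrightarrow> 0) at_top" by simp
      qed
      show "((\<lambda>t. exp (- b * complex_of_real t)) \<longlongrightarrow> 0) at_top" by (rule *) fact
      show "((\<lambda>t. exp (- complex_of_real t)) \<longlongrightarrow> 0) at_top" using *[of 1] by simp
    qed auto
    thus "((F \<circ> real_of_ereal) \<longlongrightarrow> 0) (at_left \<infinity>)"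
      unfolding ereal_tendsto_simps by simp
  qed auto
  also have "(LBINT t=0..\<infinity>. f t) = (LINT t:{0<..}|lborel. f t)"
    by (simp add: interval_lebesgue_integral_def E)
  also have "\<dots> = w * (LINT t:{0<..}|lborel. f2 t) + b * (LINT t:{0<..}|lborel. f1 t)"
    unfolding f_def by (subst set_integral_add) (auto intro: int1 int2)
  also have "0 - F 0 = 1 / (1 - w)" by (simp add: F_def)
  finally show ?thesis
    by (simp add: f1_def[abs_def] f2_def[abs_def] lerch_moment_def lerch_moment_deriv_def)
qed

text \<open>At w = 0 the differential equation reduces to b J = 1, the case k = 0; differentiating
  in \<open>b\<close> then yields each next \<open>k\<close>.\<close>

lemma lerch_moment_0:
  assumes "Re b > 0"
  shows "lerch_moment 0 k b = fact k / b ^ Suc k"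
  using assms
proof (induction k arbitrary: b)
  case 0
  have "b \<noteq> 0" using 0 by auto
  moreover have "(0::complex) \<in> lerch_domain" by (auto simp: lerch_domain_def)
  ultimately show ?case using lerch_moment_ode[OF 0, of 0] by (simp add: field_simps)
next
  case (Suc k)
  have nz: "b \<noteq> 0" using Suc.prems by auto
  have "(0::complex) \<in> lerch_domain" by (auto simp: lerch_domain_def)
  hence "(lerch_moment 0 k has_field_derivative - lerch_moment 0 (Suc k) b) (at b)"
    using Suc.prems by (intro lerch_moment_has_field_derivative)
  moreover have "(lerch_moment 0 k has_field_derivative - (fact (Suc k) / b ^ Suc (Suc k))) (at b)"
  proof (rule has_field_derivative_transform_within_open)
    have "((\<lambda>b. inverse (b ^ Suc k)) has_field_derivative - (of_nat (Suc k) / b ^ Suc (Suc k))) (at b)"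
      using nz has_field_derivative_inverse_power_shift[of b 0 k] by simp
    from DERIV_cmult[OF this, of "fact k"]
    show "((\<lambda>b. fact k / b ^ Suc k) has_field_derivative - (fact (Suc k) / b ^ Suc (Suc k))) (at b)"
      by (simp add: divide_inverse algebra_simps)
    show "open {c. Re c > 0}" by (rule open_halfspace_Re_gt)
  qed (use Suc in auto)
  ultimately have "- lerch_moment 0 (Suc k) b = - (fact (Suc k) / b ^ Suc (Suc k))"
    by (rule DERIV_unique)
  thus ?case by simp
qed

text \<open>With q = exp (-t), this is 1 / (1 - w q) = 1 + w q / (1 - w q) under the integral. The
  extra q turns \<open>b\<close> into \<open>b + 1\<close>, and the term 1 gives the moment at w =
  0; its denominator is written \<open>1 - 0 * exp (- of_real t)\<close> in the proof to match that
  moment.\<close>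

lemma lerch_moment_shift:
  assumes "Re b > 0" "w \<in> lerch_domain"
  shows "lerch_moment w k b = fact k / b ^ Suc k + w * lerch_moment w k (b + 1)"
proof -
  have 0: "(0::complex) \<in> lerch_domain" by (auto simp: lerch_domain_def)
  have "lerch_moment w k b = (LINT t:{0<..}|lborel. of_real t ^ k * exp (- b * of_real t) / (1 - 0 * exp (- of_real t)) ^ 1
     + w * (of_real t ^ k * exp (- (b+1) * of_real t) / (1 - w * exp (- of_real t)) ^ 1))"
    unfolding lerch_moment_def
  proof (intro set_lebesgue_integral_cong allI impI)
    fix t :: real assume "t \<in> {0<..}"
    hence "1 - w * exp (- of_real t) \<noteq> 0" using lerch_domain_denominator_nonzero[OF assms(2)] by auto
    moreover have "exp (- (b+1) * of_real t) = exp (- b * of_real t) * exp (- of_real t)"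
      by (simp add: algebra_simps flip: exp_add)
    ultimately show "of_real t ^ k * exp (- b * of_real t) / (1 - w * exp (- of_real t)) =
       of_real t ^ k * exp (- b * of_real t) / (1 - 0 * exp (- of_real t)) ^ 1
     + w * (of_real t ^ k * exp (- (b+1) * of_real t) / (1 - w * exp (- of_real t)) ^ 1)"
      by (simp add: field_simps)
  qed auto
  also have "\<dots> = lerch_moment 0 k b + w * lerch_moment w k (b + 1)"
    unfolding lerch_moment_def power_one_right set_integral_mult_right[symmetric]
    by (intro set_integral_add set_integrable_mult_right lerch_integrable[where j = 1, unfolded power_one_right])
       (use assms 0 in auto)
  finally show ?thesis using lerch_moment_0[OF assms(1)] by simp
qed

text \<open>Raising \<open>b\<close> by M multiplies the integrand by exp (-t)^M, which tends to 0
  and is at most 1 for t > 0. The integrand for M = 0 therefore dominates.\<close>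

lemma lerch_moment_tendsto_0:
  assumes "Re b > 0" "w \<in> lerch_domain"
  shows "(\<lambda>M. lerch_moment w k (b + of_nat M)) \<longlonglongrightarrow> 0"
proof -
  define f where "f b t = of_real t ^ k * exp (- b * of_real t) / (1 - w * exp (- of_real t))"
    for b :: complex and t :: real
  have int: "set_integrable lborel {0<..} (f (b + of_nat M))" for M
    unfolding f_def[abs_def] using lerch_integrable[of "b + of_nat M" w k 1, unfolded power_one_right] assms by simp
  have eq: "norm (f (b + of_nat M) t) = norm (f b t) * exp (- t) ^ M" for M t
  proof -
    have "exp (- (b + of_nat M) * of_real t) = exp (- b * of_real t) * exp (- of_real t) ^ M"
      by (simp add: algebra_simps flip: exp_add exp_of_nat_mult)
    thus ?thesis by (simp add: f_def norm_divide norm_mult norm_power)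
  qed
  have "(\<lambda>M. LINT t:{0<..}|lborel. f (b + of_nat M) t) \<longlonglongrightarrow> (LINT t:{0::real<..}|lborel. 0)"
    unfolding set_lebesgue_integral_def
  proof (rule integral_dominated_convergence)
    show "(\<lambda>t. indicator {0<..} t *\<^sub>R f (b + of_nat M) t) \<in> borel_measurable lborel" for M
      using int[of M] by (auto simp: set_integrable_def)
    show "integrable lborel (\<lambda>t. norm (indicator {0<..} t *\<^sub>R f b t))"
      using integrable_norm[OF int[of 0, unfolded set_integrable_def]] by simp
    show "AE t in lborel. (\<lambda>M. indicator {0<..} t *\<^sub>R f (b + of_nat M) t) \<longlonglongrightarrow> indicator {0<..} t *\<^sub>R 0"
    proof (intro always_eventually allI)
      fix t :: real
      have "(\<lambda>M. f (b + of_nat M) t) \<longlonglongrightarrow> 0" if "t > 0"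
      proof (rule tendsto_norm_zero_cancel)
        have "(\<lambda>M. norm (f b t) * exp (- t) ^ M) \<longlonglongrightarrow> norm (f b t) * 0"
          using that by (intro tendsto_intros LIMSEQ_power_zero) auto
        thus "(\<lambda>M. norm (f (b + of_nat M) t)) \<longlonglongrightarrow> 0" by (simp add: eq)
      qed
      thus "(\<lambda>M. indicator {0<..} t *\<^sub>R f (b + of_nat M) t) \<longlonglongrightarrow> indicator {0<..} t *\<^sub>R 0"
        by (auto simp: indicator_def)
    qed
    show "AE t in lborel. norm (indicator {0<..} t *\<^sub>R f (b + of_nat M) t) \<le> norm (indicator {0<..} t *\<^sub>R f b t)" for M
      by (intro always_eventually) (auto simp: indicator_def eq intro!: mult_left_le power_le_one)
  qed auto
  thus ?thesis by (simp add: f_def lerch_moment_def)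
qed

subsection \<open>Continuation in the shift parameter\<close>

text \<open>The result of \<open>M\<close> applications of the shift relation. For
  \<open>Re b > - M\<close> the remainder moment is a convergent integral, so any poles come from
  the finite sum.\<close>

definition lerch_partial :: "complex \<Rightarrow> nat \<Rightarrow> nat \<Rightarrow> complex \<Rightarrow> complex" where
  "lerch_partial w k M b =
     (\<Sum>m<M. w ^ m / (b + of_nat m) ^ Suc k) + w ^ M * (lerch_moment w k (b + of_nat M) / fact k)"

text \<open>The index is the least natural number M with \<open>Re b > - M\<close>. At a nonpositive
  integer \<open>b\<close> the singular term is 0, because division by zero gives 0.\<close>

definition lerch_ext :: "complex \<Rightarrow> nat \<Rightarrow> complex \<Rightarrow> complex" where
  "lerch_ext w k b = lerch_partial w k (nat (\<lfloor>- Re b\<rfloor> + 1)) b"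

lemma lerch_partial_Suc:
  assumes "w \<in> lerch_domain" "Re b > - real M"
  shows "lerch_partial w k (Suc M) b = lerch_partial w k M b"
proof -
  have "lerch_moment w k (b + of_nat M) =
          fact k / (b + of_nat M) ^ Suc k + w * lerch_moment w k (b + of_nat M + 1)"
    using assms by (intro lerch_moment_shift) auto
  thus ?thesis by (simp add: lerch_partial_def field_simps)
qed

text \<open>Beyond the threshold a further shift changes nothing. Although the index in
  \<open>lerch_ext\<close> jumps with \<open>Re b\<close>, one fixed \<open>M\<close> thus
  represents it on a whole open half-plane, where local properties can be checked.\<close>

lemma lerch_ext_eq:
  assumes "w \<in> lerch_domain" "Re b > - real M"
  shows "lerch_ext w k b = lerch_partial w k M b"
proof -
  define N where "N = nat (\<lfloor>- Re b\<rfloor> + 1)"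
  have "N \<le> M" unfolding N_def using assms(2) by linarith
  have "Re b > - real N" unfolding N_def by linarith
  from \<open>N \<le> M\<close> have "lerch_partial w k M b = lerch_partial w k N b"
  proof (induction M rule: dec_induct)
    case (step j)
    thus ?case using lerch_partial_Suc[OF assms(1), of j b k] \<open>Re b > - real N\<close> by simp
  qed auto
  thus ?thesis by (simp add: lerch_ext_def N_def)
qed

lemma lerch_ext_eq_moment:
  assumes "w \<in> lerch_domain" "Re b > 0"
  shows "lerch_ext w k b = lerch_moment w k b / fact k"
  using lerch_ext_eq[of w 0 b k] assms by (simp add: lerch_partial_def)

text \<open>On the half-plane of a fixed \<open>M\<close> the finite sum and the shifted moment are
  differentiated separately. The factor \<open>Suc k\<close> arises from the powers in the sum and
  from (k+1)! / k! in the remainder.\<close>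

lemma lerch_ext_has_field_derivative:
  assumes "w \<in> lerch_domain" "b \<notin> \<int>\<^sub>\<le>\<^sub>0"
  shows "(lerch_ext w k has_field_derivative - of_nat (Suc k) * lerch_ext w (Suc k) b) (at b)"
proof -
  obtain M :: nat where M: "- Re b < real M" using reals_Archimedean2 by blast
  have nz: "b + of_nat m \<noteq> 0" for m
  proof
    assume "b + of_nat m = 0"
    hence "b = - of_nat m" by (simp add: add_eq_0_iff2)
    thus False using assms(2) by auto
  qed
  have "(lerch_ext w k has_field_derivative
          (\<Sum>m<M. w ^ m * - (of_nat (Suc k) / (b + of_nat m) ^ Suc (Suc k))) +
          w ^ M * (- lerch_moment w (Suc k) (b + of_nat M) / fact k)) (at b)"
  proof (rule has_field_derivative_transform_within_open)
    show "open {c. Re c > - real M}" by (rule open_halfspace_Re_gt)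
    show "lerch_partial w k M c = lerch_ext w k c" if "c \<in> {c. Re c > - real M}" for c
      using lerch_ext_eq[OF assms(1)] that by simp
    have "((\<lambda>c. w ^ m / (c + of_nat m) ^ Suc k) has_field_derivative
             w ^ m * - (of_nat (Suc k) / (b + of_nat m) ^ Suc (Suc k))) (at b)" for m
      using DERIV_cmult[OF has_field_derivative_inverse_power_shift[OF nz]] by (simp only: divide_inverse)
    moreover have "((\<lambda>c. lerch_moment w k (c + of_nat M)) has_field_derivative
                     - lerch_moment w (Suc k) (b + of_nat M)) (at b)"
      using lerch_moment_has_field_derivative[of "b + of_nat M" w k] M assms
      by (simp add: DERIV_shift)
    ultimately show "(lerch_partial w k M has_field_derivative
          (\<Sum>m<M. w ^ m * - (of_nat (Suc k) / (b + of_nat m) ^ Suc (Suc k))) +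
          w ^ M * (- lerch_moment w (Suc k) (b + of_nat M) / fact k)) (at b)"
      unfolding lerch_partial_def by (intro DERIV_add DERIV_sum DERIV_cmult DERIV_cdivide)
  qed (use M in auto)
  also have "(\<Sum>m<M. w ^ m * - (of_nat (Suc k) / (b + of_nat m) ^ Suc (Suc k))) +
          w ^ M * (- lerch_moment w (Suc k) (b + of_nat M) / fact k) =
        - of_nat (Suc k) * lerch_partial w (Suc k) M b"
  proof -
    have alg: "x * - (y / z) = - y * (x / z)" for x y z :: complex by simp
    have "w ^ M * (- lerch_moment w (Suc k) (b + of_nat M) / fact k) =
            - of_nat (Suc k) * (w ^ M * (lerch_moment w (Suc k) (b + of_nat M) / fact (Suc k)))"
      unfolding fact_Suc using of_nat_neq_0[of k, where 'a = complex] by (simp add: divide_simps del: of_nat_Suc)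
    moreover have "(\<Sum>m<M. w ^ m * - (of_nat (Suc k) / (b + of_nat m) ^ Suc (Suc k))) =
            - of_nat (Suc k) * (\<Sum>m<M. w ^ m / (b + of_nat m) ^ Suc (Suc k))"
      unfolding sum_distrib_left by (intro sum.cong refl alg)
    ultimately show ?thesis unfolding lerch_partial_def by (simp only: distrib_left)
  qed
  also have "lerch_partial w (Suc k) M b = lerch_ext w (Suc k) b"
    using lerch_ext_eq[OF assms(1), of M b "Suc k"] M by simp
  finally show ?thesis .
qed

lemma lerch_ext_holomorphic:
  assumes "w \<in> lerch_domain"
  shows "lerch_ext w k holomorphic_on (- \<int>\<^sub>\<le>\<^sub>0)"
  using lerch_ext_has_field_derivative[OF assms] has_field_derivative_at_within
  unfolding holomorphic_on_def field_differentiable_def by blast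

text \<open>Near any point, poles included, the function is finitely many rational terms plus an
  analytic remainder.\<close>

lemma lerch_ext_meromorphic:
  assumes "w \<in> lerch_domain"
  shows "lerch_ext w k meromorphic_on UNIV"
  unfolding meromorphic_on_meromorphic_at[of _ UNIV]
proof
  fix b :: complex
  obtain M :: nat where M: "- Re b < real M" using reals_Archimedean2 by blast
  define S where "S = {c. Re c > - real M}"
  have S: "open S" "b \<in> S" using M open_halfspace_Re_gt by (auto simp: S_def)
  have "(\<lambda>c. lerch_moment w k (c + of_nat M)) holomorphic_on S"
    unfolding holomorphic_on_open[OF S(1)]
  proof
    fix c assume "c \<in> S"
    thus "\<exists>f'. ((\<lambda>c. lerch_moment w k (c + of_nat M)) has_field_derivative f') (at c)"
      using lerch_moment_has_field_derivative[of "c + of_nat M" w k] assms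
      by (auto simp: DERIV_shift S_def)
  qed
  hence "(\<lambda>c. lerch_moment w k (c + of_nat M)) meromorphic_on S"
    using S by (intro analytic_on_imp_meromorphic_on) (simp add: analytic_on_open)
  hence "(\<lambda>c. lerch_moment w k (c + of_nat M)) meromorphic_on {b}"
    by (rule meromorphic_on_subset) (use S in auto)
  hence "lerch_partial w k M meromorphic_on {b}"
    unfolding lerch_partial_def by (intro meromorphic_intros)
  also have "?this \<longleftrightarrow> lerch_ext w k meromorphic_on {b}"
  proof (intro meromorphic_on_cong refl)
    fix c assume "c \<in> {b}"
    hence "eventually (\<lambda>x. x \<in> S) (at c)" using S by (intro eventually_at_in_open') auto
    thus "eventually (\<lambda>x. lerch_partial w k M x = lerch_ext w k x) (at c)"
      by eventually_elim (use lerch_ext_eq[OF assms] in \<open>auto simp: S_def\<close>)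
  qed
  finally show "lerch_ext w k meromorphic_on {b}" .
qed

section \<open>Identification with the Lerch transcendent\<close>

lemma lerch_integral_eq_moment:
  assumes "w \<in> lerch_domain" "Re b > 0"
  shows "lerch_integral w (of_nat (Suc k)) b = lerch_moment w k b / fact k"
proof -
  have "integral {0<..} (\<lambda>t::real. of_real t powr (of_nat (Suc k) - 1) * exp (- b * of_real t) /
                                (1 - w * exp (- of_real t))) =
        integral {0<..} (\<lambda>t::real. of_real t ^ k * exp (- b * of_real t) /
                                (1 - w * exp (- of_real t)))"
    by (intro integral_cong) (simp add: powr_nat')
  \<comment> \<open>Absolute integrability makes the gauge integral of \<open>lerch_integral\<close>
    agree with the Lebesgue integral.\<close>
  also have "\<dots> = lerch_moment w k b"
    unfolding lerch_moment_def using lerch_integrable[OF assms(2,1), of k 1, unfolded power_one_right]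
    by (rule set_borel_integral_eq_integral(2)[symmetric])
  finally show ?thesis
    unfolding lerch_integral_def using Gamma_fact[of k, where 'a = complex] by simp
qed

lemma lerch_continuation_lerch_ext:
  assumes "w \<in> lerch_domain"
  shows "lerch_continuation w (Suc k) (lerch_ext w k)"
  unfolding lerch_continuation_def
  using lerch_ext_meromorphic lerch_ext_holomorphic lerch_ext_eq_moment lerch_integral_eq_moment assms
  by metis

text \<open>The plane minus a countable set is connected, so agreement on \<open>Re b > 0\<close>
  spreads by the identity theorem. Hence the function chosen by \<open>SOME\<close> in
  \<open>lerch_phi\<close> is determined off the poles.\<close>

lemma lerch_continuation_unique:
  assumes "lerch_continuation w n F" "lerch_continuation w n G" "b \<notin> \<int>\<^sub>\<le>\<^sub>0"
  shows "F b = G b"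
proof -
  define S :: "complex set" where "S = - \<int>\<^sub>\<le>\<^sub>0"
  have "countable (\<int>\<^sub>\<le>\<^sub>0 :: complex set)"
    by (rule countable_subset[of _ \<int>]) (auto simp: countable_int)
  hence conn: "connected S"
    using connected_open_diff_countable[of "UNIV :: complex set" "\<int>\<^sub>\<le>\<^sub>0"]
    by (simp add: S_def Compl_eq_Diff_UNIV connected_UNIV)
  have op: "open S" by (simp add: S_def open_Compl)
  have "F b - G b = 0"
  proof (rule analytic_continuation[of "\<lambda>b. F b - G b" S "{b. Re b > 0}" 1])
    show "(\<lambda>b. F b - G b) holomorphic_on S"
      using assms by (auto simp: lerch_continuation_def S_def intro!: holomorphic_intros)
    show "(1::complex) islimpt {b. Re b > 0}"
      using open_halfspace_Re_gt[of 0] by (intro interior_limit_point) (simp add: interior_open)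
    show "{b. Re b > 0} \<subseteq> S" by (auto simp: S_def elim!: nonpos_Ints_cases)
  qed (use assms conn op in \<open>auto simp: S_def lerch_continuation_def\<close>)
  thus ?thesis by simp
qed

lemma lerch_phi_eq_lerch_ext_outside:
  assumes "w \<in> lerch_domain" "norm w \<ge> 1" "b \<notin> \<int>\<^sub>\<le>\<^sub>0"
  shows "lerch_phi w (Suc k) b = lerch_ext w k b"
proof -
  have "lerch_continuation w (Suc k) (SOME F. lerch_continuation w (Suc k) F)"
    by (rule someI[where P = "lerch_continuation w (Suc k)"], rule lerch_continuation_lerch_ext[OF assms(1)])
  from lerch_continuation_unique[OF this lerch_continuation_lerch_ext[OF assms(1)] assms(3)]
  show ?thesis using assms(2) by (simp add: lerch_phi_def)
qed

text \<open>The remainder tends to 0, since the powers of \<open>w\<close> are bounded and the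
  shifted moments vanish in the limit. The boundary \<open>norm w = 1\<close> is included because w
  = -1 fixes the integration constant later.\<close>

lemma lerch_ext_sums:
  assumes "w \<in> lerch_domain" "norm w \<le> 1"
  shows "(\<lambda>m. w ^ m / (b + of_nat m) ^ Suc k) sums lerch_ext w k b"
proof -
  \<comment> \<open>Shifting by \<open>N\<close> moves \<open>b\<close> into the right half-plane,
    where the decay of the moments is known.\<close>
  obtain N :: nat where N: "- Re b < real N" using reals_Archimedean2 by blast
  have "(\<lambda>M. lerch_moment w k (b + of_nat N + of_nat M)) \<longlonglongrightarrow> 0"
    using N assms(1) by (intro lerch_moment_tendsto_0) auto
  hence "(\<lambda>M. lerch_moment w k (b + of_nat (M + N))) \<longlonglongrightarrow> 0"
    by (simp add: add_ac)
  hence lim: "(\<lambda>M. lerch_moment w k (b + of_nat M)) \<longlonglongrightarrow> 0"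
    by (rule LIMSEQ_offset)
  have "(\<lambda>M. w ^ M * (lerch_moment w k (b + of_nat M) / fact k)) \<longlonglongrightarrow> 0"
  proof (rule Lim_null_comparison)
    show "eventually (\<lambda>M. norm (w ^ M * (lerch_moment w k (b + of_nat M) / fact k)) \<le>
            norm (lerch_moment w k (b + of_nat M) / fact k)) sequentially"
      using assms(2) unfolding norm_mult norm_power
      by (intro always_eventually allI mult_left_le_one_le power_le_one) auto
    show "(\<lambda>M. norm (lerch_moment w k (b + of_nat M) / fact k)) \<longlonglongrightarrow> 0"
      using tendsto_norm[OF tendsto_divide[OF lim tendsto_const[of "fact k"]]] by simp
  qed
  hence "(\<lambda>M. lerch_ext w k b - w ^ M * (lerch_moment w k (b + of_nat M) / fact k)) \<longlonglongrightarrow> lerch_ext w k b"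
    using tendsto_diff[OF tendsto_const[of "lerch_ext w k b"]] unfolding diff_zero by (metis diff_zero)
  moreover have "eventually (\<lambda>M. lerch_ext w k b - w ^ M * (lerch_moment w k (b + of_nat M) / fact k) =
                   (\<Sum>m<M. w ^ m / (b + of_nat m) ^ Suc k)) sequentially"
    using eventually_ge_at_top[of N]
  proof eventually_elim
    case (elim M)
    thus ?case using lerch_ext_eq[OF assms(1), of M b k] N by (simp add: lerch_partial_def)
  qed
  ultimately show ?thesis unfolding sums_def by (rule Lim_transform_eventually)
qed

lemma lerch_phi_eq_lerch_ext_inside:
  assumes "norm w < 1" "b \<notin> \<int>\<^sub>\<le>\<^sub>0"
  shows "lerch_phi w (Suc k) b = lerch_ext w k b"
proof -
  have "w \<in> lerch_domain" using assms by (auto simp: lerch_domain_def)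
  hence "(\<lambda>m. w ^ m / (b + of_nat m) ^ Suc k) sums lerch_ext w k b"
    using assms by (intro lerch_ext_sums) auto
  moreover have "(b + of_nat m) powr of_nat (Suc k) = (b + of_nat m) ^ Suc k" for m
  proof -
    have "b + of_nat m \<noteq> 0"
    proof
      assume "b + of_nat m = 0"
      hence "b = - of_nat m" by (simp add: add_eq_0_iff2)
      thus False using assms(2) by auto
    qed
    thus ?thesis using powr_nat'[of "b + of_nat m" "Suc k"] by blast
  qed
  ultimately show ?thesis
    using assms(1) by (simp only: lerch_phi_def lerch_series_def) (simp add: sums_iff)
qed

subsection \<open>The reflection formula in the strip\<close>

text \<open>Differentiate both sides of Gamma(z) Gamma(1-z) = pi / sin (pi z) and divide by the
  product.\<close>

lemma Digamma_reflection_complex: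
  fixes z :: complex
  assumes "z \<notin> \<int>"
  shows "Digamma (1 - z) - Digamma z = of_real pi * cot (of_real pi * z)"
proof -
  have z: "z \<notin> \<int>\<^sub>\<le>\<^sub>0" "1 - z \<notin> \<int>\<^sub>\<le>\<^sub>0"
    using assms nonpos_Ints_Int by (auto dest: Ints_diff[OF Ints_1])
  have sin0: "sin (of_real pi * z) \<noteq> 0"
    using assms by (auto simp: sin_eq_0)
  have "((\<lambda>z. Gamma z * Gamma (1 - z)) has_field_derivative
          Gamma z * Gamma (1 - z) * (Digamma z - Digamma (1 - z))) (at z)"
    using z by (auto intro!: derivative_eq_intros simp: algebra_simps)
  moreover have "((\<lambda>z. of_real pi / sin (of_real pi * z)) has_field_derivative
          - (of_real pi * (of_real pi * cos (of_real pi * z)) / (sin (of_real pi * z) * sin (of_real pi * z)))) (at z)"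
    using sin0 by (auto intro!: derivative_eq_intros simp: algebra_simps)
  ultimately have "Gamma z * Gamma (1 - z) * (Digamma z - Digamma (1 - z)) =
     - (of_real pi * (of_real pi * cos (of_real pi * z)) / (sin (of_real pi * z) * sin (of_real pi * z)))"
    unfolding Gamma_reflection_complex by (rule DERIV_unique)
  moreover have "d1 - d2 = p * (c / s)"
    if "p / s * (d2 - d1) = - (p * (p * c) / (s * s))" "p \<noteq> 0" "s \<noteq> 0" for p s c d1 d2 :: complex
  proof -
    have "d1 - d2 = - (s / p) * (p / s * (d2 - d1))" using that(2,3) by simp
    also have "\<dots> = p * (c / s)" unfolding that(1) using that(2,3) by simp
    finally show ?thesis .
  qed
  ultimately show ?thesis
    unfolding Gamma_reflection_complex cot_def using sin0 by simp
qed

text \<open>The even and odd terms of the alternating series have step 2; halving turns them into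
  the series of the digamma function at b/2 and (b+1)/2.\<close>

lemma lerch_ext_minus_one:
  assumes "Re b > 0"
  shows "lerch_ext (-1) 0 b = (Digamma ((b + 1) / 2) - Digamma (b / 2)) / 2"
proof -
  have "(-1::complex) \<in> lerch_domain"
    by (auto simp: lerch_domain_def complex_eq_iff)
  hence "(\<lambda>m. (-1) ^ m / (b + of_nat m) ^ Suc 0) sums lerch_ext (-1) 0 b"
    by (rule lerch_ext_sums) auto
  hence "(\<lambda>M. \<Sum>m<M. (-1) ^ m / (b + of_nat m)) \<longlonglongrightarrow> lerch_ext (-1) 0 b"
    by (simp add: sums_def)
  hence 1: "(\<lambda>M. \<Sum>m<2*M. (-1) ^ m / (b + of_nat m)) \<longlonglongrightarrow> lerch_ext (-1) 0 b"
    by (rule filterlim_compose) (auto intro!: filterlim_subseq strict_monoI)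
  \<comment> \<open>\<open>D z M\<close> tends to \<open>Digamma z\<close>, and the divergent
    logarithms cancel in the difference of two such approximants.\<close>
  define D where "D z M = of_real (ln (real M)) - (\<Sum>n<M. inverse (z + of_nat n))"
    for z :: complex and M
  have nz: "b + of_nat m \<noteq> 0" for m
    using assms by (auto simp: complex_eq_iff)
  have eq: "(\<Sum>m<2*M. (-1) ^ m / (b + of_nat m)) = (D ((b + 1) / 2) M - D (b / 2) M) / 2" for M
  proof -
    have "(\<Sum>m<2*M. (-1) ^ m / (b + of_nat m)) =
            ((\<Sum>n<M. inverse (b / 2 + of_nat n)) - (\<Sum>n<M. inverse ((b + 1) / 2 + of_nat n))) / 2"
    proof (induction M)
      case (Suc M)
      have e1: "inverse (b / 2 + of_nat M) = 2 * (1 / (b + of_nat (2 * M)))"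
        using nz[of "2 * M"] by (simp add: divide_simps mult.commute)
      have e2: "inverse ((b + 1) / 2 + of_nat M) = 2 * (1 / (b + of_nat (Suc (2 * M))))"
        using nz[of "Suc (2 * M)"] by (simp add: divide_simps mult.commute add_ac)
      have "(\<Sum>m<2 * Suc M. (-1) ^ m / (b + of_nat m)) =
              (\<Sum>m<2 * M. (-1) ^ m / (b + of_nat m)) + 1 / (b + of_nat (2 * M)) - 1 / (b + of_nat (Suc (2 * M)))"
        by simp
      moreover have "(x - y) / 2 + u - v = ((x + 2 * u) - (y + 2 * v)) / 2" for x y u v :: complex
        by (simp add: field_simps)
      ultimately show ?case unfolding Suc.IH sum.lessThan_Suc e1 e2 by simp
    qed auto
    thus ?thesis by (simp add: D_def)
  qed
  have "b / 2 \<noteq> 0" "(b + 1) / 2 \<noteq> 0" using nz[of 0] nz[of 1] by auto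
  hence "(\<lambda>M. (D ((b + 1) / 2) M - D (b / 2) M) / 2)
           \<longlonglongrightarrow> (Digamma ((b + 1) / 2) - Digamma (b / 2)) / 2"
    unfolding D_def by (intro tendsto_intros Digamma_LIMSEQ) auto
  with 1 show ?thesis unfolding eq by (rule LIMSEQ_unique)
qed

lemma lerch_ext_minus_one_reflection:
  assumes "0 < Re a" "Re a < 1"
  shows "lerch_ext (-1) 0 a + lerch_ext (-1) 0 (1 - a) = of_real pi / sin (of_real pi * a)"
proof -
  define x where "x = of_real pi * (a / 2)"
  have nonint: "b \<notin> \<int>" if "0 < Re b" "Re b < 1" for b :: complex
    using that by (auto elim!: Ints_cases)
  have y: "of_real pi * ((1 - a) / 2) = of_real pi / 2 - x" by (simp add: x_def field_simps)
  have nz: "sin x \<noteq> 0" "cos x \<noteq> 0"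
  proof -
    show "sin x \<noteq> 0"
      using nonint[of "a / 2"] assms by (auto simp: x_def sin_eq_0)
    have "sin (of_real pi * ((1 - a) / 2)) \<noteq> 0"
      using nonint[of "(1 - a) / 2"] assms by (auto simp: sin_eq_0)
    thus "cos x \<noteq> 0" unfolding y by (simp add: sin_diff)
  qed
  \<comment> \<open>The four digamma values are regrouped crosswise, so that the reflection formula
    applies at a/2 and at (1-a)/2.\<close>
  have "lerch_ext (-1) 0 a + lerch_ext (-1) 0 (1 - a) =
          (Digamma (1 - a / 2) - Digamma (a / 2) + (Digamma (1 - (1 - a) / 2) - Digamma ((1 - a) / 2))) / 2"
    using assms by (simp add: lerch_ext_minus_one field_simps)
  also have "\<dots> = of_real pi * (cot x + cot (of_real pi / 2 - x)) / 2"
  proof -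
    have "a / 2 \<notin> \<int>" "(1 - a) / 2 \<notin> \<int>" by (rule nonint; use assms in simp)+
    from this[THEN Digamma_reflection_complex] show ?thesis
      unfolding y x_def[symmetric] by (simp only: distrib_left)
  qed
  \<comment> \<open>The second cotangent is tan x, and cot x + tan x = 2 / sin (2 x).\<close>
  also have "cot x + cot (of_real pi / 2 - x) = 2 / sin (2 * x)"
  proof -
    have "sin (of_real pi / 2 - x) = cos x" "cos (of_real pi / 2 - x) = sin x"
      by (simp_all add: sin_diff cos_diff)
    moreover have "c / s + s / c = 2 / (2 * s * c)" if "s \<noteq> 0" "c \<noteq> 0" "s\<^sup>2 + c\<^sup>2 = 1" for s c :: complex
      using that by (simp add: divide_simps power2_eq_square add.commute)
    ultimately show ?thesis using nz by (simp add: cot_def sin_double)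
  qed
  also have "2 * x = of_real pi * a" by (simp add: x_def)
  finally show ?thesis by simp
qed

section \<open>The differential equation in the logarithmic variable\<close>

lemma minus_exp_in_lerch_domain:
  assumes "\<bar>Im c\<bar> < pi"
  shows "- exp c \<in> lerch_domain"
  unfolding lerch_domain_def
proof
  assume "- exp c \<in> complex_of_real ` {1..}"
  then obtain r where r: "r \<ge> 1" "- exp c = complex_of_real r" by auto
  have e: "exp c = exp (of_real (ln r) + \<i> * of_real pi)"
    using r by (simp add: exp_add exp_of_real minus_equation_iff)
  \<comment> \<open>Imaginary parts less than 2 pi apart make \<open>exp\<close> injective on the
    two points, which would force \<open>Im c = pi\<close>.\<close>
  have "\<bar>Im c - pi\<bar> < 2 * pi" using assms by linarith
  hence "\<bar>Im c - Im (of_real (ln r) + \<i> * of_real pi)\<bar> < 2 * pi" by simp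
  hence "c = of_real (ln r) + \<i> * of_real pi"
    using e by (rule exp_complex_eqI)
  thus False using assms by simp
qed

lemma lerch_moment_reflection:
  assumes "0 < Re a" "Re a < 1" "\<bar>Im c\<bar> < pi"
  shows "lerch_moment (- exp c) 0 a + exp (- c) * lerch_moment (- exp (- c)) 0 (1 - a) =
           exp (- a * c) * of_real pi / sin (of_real pi * a)"
proof -
  define S where "S = {c. \<bar>Im c\<bar> < pi}"
  \<comment> \<open>This is the left-hand side at order 1 for z = - exp c; the plus sign arises from
    \<open>exp (- c) = - inverse z\<close>. The strip \<open>S\<close> is convex, invariant under
    negation, and contains 0.\<close>
  define K where "K c = lerch_moment (- exp c) 0 a + exp (- c) * lerch_moment (- exp (- c)) 0 (1 - a)" for c
  have S: "S = {c. Im c < pi} \<inter> {c. Im c > - pi}" by (auto simp: S_def)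
  have "convex S" unfolding S by (intro convex_Int convex_halfspace_Im_gt convex_halfspace_Im_lt)
  moreover have "((\<lambda>c. exp (a * c) * K c) has_field_derivative 0) (at c within S)" if "c \<in> S" for c
  proof -
    have dom: "- exp c \<in> lerch_domain" "- exp (- c) \<in> lerch_domain"
      using that minus_exp_in_lerch_domain[of c] minus_exp_in_lerch_domain[of "-c"] by (auto simp: S_def)
    have ne: "1 + exp c \<noteq> 0"
      using lerch_domain_denominator_nonzero[OF dom(1), of 0] by simp
    define J1 J2 where "J1 = lerch_moment (- exp c) 0 a" and "J2 = lerch_moment (- exp (- c)) 0 (1 - a)"
    define D1 D2 where "D1 = lerch_moment_deriv (- exp c) a" and "D2 = lerch_moment_deriv (- exp (- c)) (1 - a)"
    have 1: "((\<lambda>c. lerch_moment (- exp c) 0 a) has_field_derivative D1 * (- exp c)) (at c)"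
      unfolding D1_def using assms dom
      by (intro DERIV_chain2[OF lerch_moment_has_field_derivative_arg]) (auto intro!: derivative_eq_intros)
    have 2: "((\<lambda>c. lerch_moment (- exp (- c)) 0 (1 - a)) has_field_derivative D2 * exp (- c)) (at c)"
      unfolding D2_def using assms dom
      by (intro DERIV_chain2[OF lerch_moment_has_field_derivative_arg]) (auto intro!: derivative_eq_intros)
    have o1: "- exp c * D1 = 1 / (1 + exp c) - a * J1"
      using lerch_moment_ode[of a "- exp c"] assms dom by (simp add: D1_def J1_def algebra_simps)
    have o2: "exp (- c) * D2 = (1 - a) * J2 - 1 / (1 + exp (- c))"
      using lerch_moment_ode[of "1 - a" "- exp (- c)"] assms dom by (simp add: D2_def J2_def algebra_simps)
    have "((\<lambda>c. exp (a * c) * K c) has_field_derivative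
             a * exp (a * c) * (J1 + exp (- c) * J2) +
             exp (a * c) * (- exp c * D1 + (- exp (- c) * J2 + exp (- c) * (exp (- c) * D2)))) (at c)"
      unfolding K_def
      by (rule derivative_eq_intros 1 2 refl | simp add: J1_def J2_def algebra_simps)+
    also have "a * exp (a * c) * (J1 + exp (- c) * J2) +
             exp (a * c) * (- exp c * D1 + (- exp (- c) * J2 + exp (- c) * (exp (- c) * D2))) =
           exp (a * c) * (1 / (1 + exp c) - exp (- c) / (1 + exp (- c)))"
      unfolding o1 o2 by (simp add: algebra_simps)
    \<comment> \<open>The terms in the two moments have already cancelled; here the boundary terms
      of the two differential equations cancel as well.\<close>
    also have "exp (- c) / (1 + exp (- c)) = 1 / (1 + exp c)"
      using ne by (simp add: exp_minus divide_simps add.commute)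
    finally show ?thesis by (auto intro: has_field_derivative_at_within)
  qed
  ultimately obtain C where C: "\<And>c. c \<in> S \<Longrightarrow> exp (a * c) * K c = C"
    using has_field_derivative_zero_constant[of S "\<lambda>c. exp (a * c) * K c"] by blast
  \<comment> \<open>The constant is read off at c = 0, where both moments have the argument
    -1.\<close>
  have "(-1::complex) \<in> lerch_domain"
    by (auto simp: lerch_domain_def complex_eq_iff)
  hence "K 0 = of_real pi / sin (of_real pi * a)"
    using lerch_ext_minus_one_reflection[OF assms(1,2)] assms
    by (simp add: K_def lerch_ext_eq_moment)
  with C[of 0] C[of c] have "exp (a * c) * K c = of_real pi / sin (of_real pi * a)"
    using assms by (simp add: S_def)
  moreover have "K c = exp (- a * c) * (exp (a * c) * K c)"
    by (simp add: mult.assoc[symmetric] flip: exp_add)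
  ultimately have "K c = exp (- a * c) * of_real pi / sin (of_real pi * a)"
    by simp
  thus ?thesis by (simp add: K_def)
qed

subsection \<open>Reflection at all orders\<close>

text \<open>The base case extends the strip identity to the connected complement of the integers by
  the identity theorem. Induction then differentiates in \<open>a\<close>, which works for any
  holomorphic \<open>R\<close>.\<close>

lemma lerch_ext_reflection:
  assumes dom: "z \<in> lerch_domain" "inverse z \<in> lerch_domain"
    and strip: "\<And>a. 0 < Re a \<Longrightarrow> Re a < 1 \<Longrightarrow>
       lerch_ext z 0 a - inverse z * lerch_ext (inverse z) 0 (1 - a) = R a"
    and R: "R holomorphic_on - \<int>"
    and a: "a \<notin> \<int>"
  shows "lerch_ext z k a + (-1) ^ Suc k * inverse z * lerch_ext (inverse z) k (1 - a) =
           (-1) ^ k / fact k * (deriv ^^ k) R a"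
  using a
proof (induction k arbitrary: a)
  case 0
  define S :: "complex set" where "S = - \<int>"
  have op: "open S" by (simp add: S_def open_Compl)
  have conn: "connected S"
    using connected_open_diff_countable[of "UNIV :: complex set" \<int>]
    by (simp add: S_def Compl_eq_Diff_UNIV connected_UNIV countable_int)
  have nonpos: "b \<notin> \<int>\<^sub>\<le>\<^sub>0" "1 - b \<notin> \<int>\<^sub>\<le>\<^sub>0" if "b \<in> S" for b
    using that nonpos_Ints_Int by (auto simp: S_def dest: Ints_diff[OF Ints_1])
  define U :: "complex set" where "U = {a. Re a > 0} \<inter> {a. Re a < 1}"
  have U: "open U" unfolding U_def by (intro open_Int open_halfspace_Re_gt open_halfspace_Re_lt)
  have half: "1/2 \<in> U" by (simp add: U_def)
  have "U \<subseteq> S" by (auto simp: U_def S_def elim!: Ints_cases)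
  have "lerch_ext z 0 a - inverse z * lerch_ext (inverse z) 0 (1 - a) - R a = 0"
  proof (rule analytic_continuation[of "\<lambda>a. lerch_ext z 0 a - inverse z * lerch_ext (inverse z) 0 (1 - a) - R a" S U "1/2"])
    have "lerch_ext z 0 holomorphic_on S"
      using lerch_ext_holomorphic[OF dom(1)] by (rule holomorphic_on_subset) (use nonpos in auto)
    moreover have "(lerch_ext (inverse z) 0 \<circ> (\<lambda>a. 1 - a)) holomorphic_on S"
      using nonpos by (intro holomorphic_on_compose_gen[OF _ lerch_ext_holomorphic[OF dom(2)]] holomorphic_intros) auto
    ultimately show "(\<lambda>a. lerch_ext z 0 a - inverse z * lerch_ext (inverse z) 0 (1 - a) - R a) holomorphic_on S"
      using R by (intro holomorphic_intros) (simp_all add: S_def o_def)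
    show "1/2 islimpt U" using U half by (intro interior_limit_point) (simp add: interior_open)
  qed (use op conn \<open>U \<subseteq> S\<close> half 0 strip in \<open>auto simp: S_def U_def\<close>)
  thus ?case by simp
next
  case (Suc k)
  define P where "P k a = lerch_ext z k a + (-1) ^ Suc k * inverse z * lerch_ext (inverse z) k (1 - a)"
    for k a
  have op: "open (- \<int> :: complex set)" by (simp add: open_Compl)
  have nonpos: "a \<notin> \<int>\<^sub>\<le>\<^sub>0" "1 - a \<notin> \<int>\<^sub>\<le>\<^sub>0"
    using Suc.prems nonpos_Ints_Int by (auto dest: Ints_diff[OF Ints_1])
  have "((\<lambda>a. lerch_ext (inverse z) k (1 - a)) has_field_derivative
          - of_nat (Suc k) * lerch_ext (inverse z) (Suc k) (1 - a) * (- 1)) (at a)"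
    by (rule DERIV_chain2[where f = "lerch_ext (inverse z) k" and g = "\<lambda>a. 1 - a",
          OF lerch_ext_has_field_derivative[OF dom(2) nonpos(2)]])
       (auto intro!: derivative_eq_intros)
  from DERIV_add[OF lerch_ext_has_field_derivative[OF dom(1) nonpos(1)] DERIV_cmult[OF this]]
  have "(P k has_field_derivative - of_nat (Suc k) * lerch_ext z (Suc k) a + (-1) ^ Suc k * inverse z *
          (- of_nat (Suc k) * lerch_ext (inverse z) (Suc k) (1 - a) * (- 1))) (at a)"
    unfolding P_def .
  also have "- of_nat (Suc k) * lerch_ext z (Suc k) a + (-1) ^ Suc k * inverse z *
          (- of_nat (Suc k) * lerch_ext (inverse z) (Suc k) (1 - a) * (- 1)) = - of_nat (Suc k) * P (Suc k) a"
    unfolding P_def distrib_left by simp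
  \<comment> \<open>Both summands acquire the same factor: the inner derivative -1 of
    \<open>1 - a\<close> supplies the sign change from \<open>(-1) ^ Suc k\<close> to the next
    power.\<close>
  finally have 1: "(P k has_field_derivative - of_nat (Suc k) * P (Suc k) a) (at a)" .
  have "(deriv ^^ k) R holomorphic_on - \<int>" using R op by (rule holomorphic_higher_deriv)
  hence "((deriv ^^ k) R has_field_derivative (deriv ^^ Suc k) R a) (at a)"
    using holomorphic_derivI[OF _ op] Suc.prems by auto
  hence "((\<lambda>a. (-1) ^ k / fact k * (deriv ^^ k) R a) has_field_derivative
           (-1) ^ k / fact k * (deriv ^^ Suc k) R a) (at a)"
    by (rule DERIV_cmult)
  hence 2: "(P k has_field_derivative (-1) ^ k / fact k * (deriv ^^ Suc k) R a) (at a)"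
    by (rule has_field_derivative_transform_within_open[OF _ op])
       (use Suc in \<open>auto simp: P_def\<close>)
  have "P (Suc k) a = (- 1 / of_nat (Suc k)) * (- of_nat (Suc k) * P (Suc k) a)"
    using of_nat_neq_0[of k, where 'a = complex] by (simp del: of_nat_Suc)
  also have "\<dots> = (- 1 / of_nat (Suc k)) * ((-1) ^ k / fact k * (deriv ^^ Suc k) R a)"
    using DERIV_unique[OF 1 2] by simp
  also have "\<dots> = (-1) ^ Suc k / fact (Suc k) * (deriv ^^ Suc k) R a"
    by (simp del: of_nat_Suc funpow.simps)
  finally show ?case by (simp only: P_def)
qed

text \<open>For \<open>Im z > 0\<close>, Ln (-z) = Ln z - i pi produces the factor exp (i pi a), and
  exp (i pi a) / sin (pi a) = cot (pi a) + i. There - Ln z lies in the lower half-plane, so the sign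
  of its argument is -1. The case \<open>Im z < 0\<close> is the mirror image.\<close>

lemma exp_Ln_minus_over_sin:
  assumes "Im z \<noteq> 0" "Ln z \<noteq> 0" "sin (of_real pi * a) \<noteq> 0"
  shows "exp (- a * Ln (- z)) / sin (of_real pi * a) =
           exp (- a * Ln z) * (cot (of_real pi * a) - of_real (sgn (Arg (- Ln z))) * \<i>)"
proof (cases "Im z > 0")
  case True
  hence nz: "z \<noteq> 0" by auto
  have "Im (Ln z) > 0" using Im_Ln_pos_lt_imp[OF True] by simp
  hence "Im (Ln (- Ln z)) < 0"
    using Im_Ln_pos_le[of "- Ln z"] Im_Ln_le_pi[of "- Ln z"] assms(2) by auto
  hence "sgn (Arg (- Ln z)) = -1" using assms(2) by (simp add: Arg_eq_Im_Ln)
  moreover have "Ln (- z) = Ln z - \<i> * of_real pi" using nz True by (simp add: Ln_minus)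
  moreover have "- a * (Ln z - \<i> * of_real pi) = - a * Ln z + \<i> * (of_real pi * a)"
    by (simp add: algebra_simps)
  ultimately show ?thesis
    using assms(3) by (simp only: exp_add exp_Euler[of "of_real pi * a"]) (simp add: cot_def add_divide_distrib distrib_left)
next
  case False
  hence neg: "Im z < 0" using assms(1) by simp
  hence nz: "z \<noteq> 0" by auto
  have "Im (Ln z) < 0" using Im_Ln_pos_le[OF nz] Im_Ln_le_pi[of z] nz neg by auto
  hence "Im (Ln (- Ln z)) > 0" using Im_Ln_pos_lt_imp[of "- Ln z"] by simp
  hence "sgn (Arg (- Ln z)) = 1" using assms(2) by (simp add: Arg_eq_Im_Ln)
  moreover have "Ln (- z) = Ln z + \<i> * of_real pi" using nz neg by (simp add: Ln_minus)
  moreover have "- a * (Ln z + \<i> * of_real pi) = - a * Ln z + \<i> * (- (of_real pi * a))"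
    by (simp add: algebra_simps)
  ultimately show ?thesis
    using assms(3) by (simp only: exp_add exp_Euler[of "- (of_real pi * a)"]) (simp add: cot_def diff_divide_distrib right_diff_distrib)
qed

theorem theorem2:
  fixes z a :: complex and n :: nat and \<phi> :: real
  assumes "0 < norm z" and "norm z < 1"
    and "- pi < Arg z" and "Arg z < pi"
    and "z \<notin> complex_of_real ` {0<..<1}"
    and "\<phi> = Arg (- Ln z)"
    and "n \<ge> 1"
    and "a \<notin> \<int>"
  shows "lerch_phi z n a + (-1) ^ n * inverse z * lerch_phi (inverse z) n (1 - a) =
           of_real pi * (-1) ^ (n - 1) / fact (n - 1) *
           (deriv ^^ (n - 1))
             (\<lambda>b. exp (- b * Ln z) * (cot (of_real pi * b) - of_real (sgn \<phi>) * \<i>)) a"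
proof -
  define Q where "Q = (\<lambda>b. exp (- b * Ln z) * (cot (of_real pi * b) - of_real (sgn \<phi>) * \<i>))"
  obtain k where n: "n = Suc k" using assms(7) by (cases n) auto
  have nz: "z \<noteq> 0" using assms(1) by auto
  \<comment> \<open>\<open>Arg z < pi\<close> rules out the negative axis, and
    \<open>norm z < 1\<close> with \<open>z\<close> outside (0,1) rules out the positive
    one.\<close>
  have Im: "Im z \<noteq> 0"
  proof
    assume "Im z = 0"
    hence z: "z = of_real (Re z)" by (simp add: complex_eq_iff)
    have "Re z > 0"
    proof (rule ccontr)
      assume "\<not> Re z > 0"
      hence "Arg z = pi" using \<open>Im z = 0\<close> nz by (simp add: Arg_eq_pi complex_eq_iff)
      thus False using assms(4) by simp
    qed
    moreover have "Re z < 1" using assms(2) complex_Re_le_cmod[of z] by simp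
    ultimately have "z \<in> complex_of_real ` {0<..<1}" by (subst z) simp
    thus False using assms(5) by simp
  qed
  have Im': "Im (inverse z) \<noteq> 0" using Im nz by (simp add: complex_is_Real_iff[symmetric] del: inverse_complex.simps)
  have dom: "z \<in> lerch_domain" "inverse z \<in> lerch_domain"
  proof -
    have "w \<in> lerch_domain" if "Im w \<noteq> 0" for w using that by (auto simp: lerch_domain_def)
    thus "z \<in> lerch_domain" "inverse z \<in> lerch_domain" using Im Im' by blast+
  qed
  have Lnz: "Ln z \<noteq> 0" using Im nz exp_Ln[OF nz] by force
  have sin0: "sin (of_real pi * b) \<noteq> 0" if "b \<notin> \<int>" for b :: complex
    using that by (auto simp: sin_eq_0)
  have Q: "Q holomorphic_on - \<int>"
    unfolding Q_def cot_def using sin0 by (intro holomorphic_intros) auto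
  have strip: "lerch_ext z 0 b - inverse z * lerch_ext (inverse z) 0 (1 - b) = of_real pi * Q b"
    if b: "0 < Re b" "Re b < 1" for b
  proof -
    \<comment> \<open>Taking the logarithm of \<open>- z\<close> puts \<open>c\<close> in the open
      strip, since \<open>Im c = pi\<close> would require \<open>z\<close> to be a positive
      real.\<close>
    define c where "c = Ln (- z)"
    have c: "- exp c = z" "- exp (- c) = inverse z"
      using nz by (simp_all add: c_def exp_minus)
    have "Im c \<noteq> pi" using Im nz by (simp add: c_def Im_Ln_eq_pi)
    hence "\<bar>Im c\<bar> < pi"
      using Im_Ln_le_pi[of "- z"] mpi_less_Im_Ln[of "- z"] nz by (simp add: c_def abs_less_iff)
    have "b \<notin> \<int>" using b by (auto elim!: Ints_cases)
    from lerch_moment_reflection[OF b \<open>\<bar>Im c\<bar> < pi\<close>]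
    have "lerch_moment z 0 b - inverse z * lerch_moment (inverse z) 0 (1 - b) =
            of_real pi * (exp (- b * c) / sin (of_real pi * b))"
      unfolding c by (simp add: c(2)[symmetric])
    also have "exp (- b * c) / sin (of_real pi * b) = Q b"
      unfolding c_def Q_def assms(6) by (rule exp_Ln_minus_over_sin[OF Im Lnz sin0[OF \<open>b \<notin> \<int>\<close>]])
    finally show ?thesis using b dom by (simp add: lerch_ext_eq_moment)
  qed
  have nonpos: "a \<notin> \<int>\<^sub>\<le>\<^sub>0" "1 - a \<notin> \<int>\<^sub>\<le>\<^sub>0"
    using assms(8) nonpos_Ints_Int by (auto dest: Ints_diff[OF Ints_1])
  \<comment> \<open>This selects the continuation branch of \<open>lerch_phi\<close> for
    \<open>inverse z\<close>, while \<open>z\<close> itself falls under the series branch.\<close>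
  have "norm (inverse z) \<ge> 1" using assms(1,2) by (simp add: norm_inverse one_le_inverse)
  hence "lerch_phi z n a + (-1) ^ n * inverse z * lerch_phi (inverse z) n (1 - a) =
          lerch_ext z k a + (-1) ^ Suc k * inverse z * lerch_ext (inverse z) k (1 - a)"
    using lerch_phi_eq_lerch_ext_inside[OF assms(2) nonpos(1)]
      lerch_phi_eq_lerch_ext_outside[OF dom(2) _ nonpos(2)] by (simp add: n)
  also have "\<dots> = (-1) ^ k / fact k * (deriv ^^ k) (\<lambda>b. of_real pi * Q b) a"
    using Q assms(8) by (intro lerch_ext_reflection dom strip holomorphic_intros)
  also have "(deriv ^^ k) (\<lambda>b. of_real pi * Q b) a = of_real pi * (deriv ^^ k) Q a"
    using Q assms(8) by (intro higher_deriv_cmult[of _ "- \<int>"]) (auto simp: open_Compl)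
  finally show ?thesis by (simp add: n Q_def)
qed

end
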